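(* Let $k,m\in\mathbb N$, $m\ge2$, let $l$ be a divisor of $m$ with $1\le l<m$, and let $t=(t^i_q)$, $1\le i\le k-1$, $(i-1)l+1\le q\le(i+1)l$, be a family of elements of $\bigtriangledown_{m/l}$. Suppose that $\sigma_i\mapsto\phi_{m,l,t}(\sigma_i)$, $1\le i\le k-1$, defines a homomorphism $\phi_{m,l,t}\colon B_k\to S_{mk}$. Then there exists $p\in\bigtriangledown_{m/l}$ such that $\phi_{m,l,t}$ is conjugate to $\phi_{m,l,t'}$, where for each $1\le i\le k-1$ and each $q$ with $(i-1)l+1\le q\le(i+1)l$ $$t'^i_q=\begin{cases}0 & q\ne(i-1)l+1,\\ p & q=(i-1)l+1.\end{cases}$$
   Context: $B_k$ is the braid group with generators $\sigma_1,\dots,\sigma_{k-1}$ and relations $\sigma_i\sigma_j=\sigma_j\sigma_i$ for $|i-j|\ge2$ and $\sigma_i\sigma_{i+1}\sigma_i=\sigma_{i+1}\sigma_i\sigma_{i+1}$. $S_n$ is the symmetric group on $\{1,\dots,n\}$ acting from the left, so $(\sigma\tau)(x)=\sigma(\tau(x))$; permutations of a subset are extended by the identity. Homomorphisms $\phi,\psi\colon G\to H$ are conjugate if there is $h\in H$ with $\psi(g)=h^{-1}\phi(g)h$ for all $g\in G$. For $n\ge1$: $\bigtriangledown_n=\{0,\dots,n-1\}$; $|a|_n\in\bigtriangledown_n$ is the residue of $a\in\mathbb Z$ modulo $n$; for $i\ge1$ and $q\in\bigtriangledown_n$ put $a^{(n)}_{i,q}=1+n(i-1)+q$; $A^n_i$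 is the $n$-cycle $(1+n(i-1),2+n(i-1),\dots,ni)$ (the identity if $n=1$). For a permutation $\sigma$ of $\{j,\dots,j+r-1\}$ and $t_j,\dots,t_{j+r-1}\in\bigtriangledown_n$, $C^{\sigma,n}_{t_j,\dots,t_{j+r-1}}$ is the permutation of $\{n(j-1)+1,\dots,n(j+r-1)\}$ given by $a^{(n)}_{i,q}\mapsto a^{(n)}_{\sigma(i),\,|q+t_{\sigma(i)}|_n}$ for $j\le i\le j+r-1$, $q\in\bigtriangledown_n$. For $l\ge1$ and $1\le i\le k-1$, $\psi_l(\sigma_i)\in S_{lk}$ is the $2l$-cycle $(a^{(l)}_{i,0},a^{(l)}_{i+1,0},a^{(l)}_{i,1},a^{(l)}_{i+1,1},\dots,a^{(l)}_{i,l-1},a^{(l)}_{i+1,l-1})$; it is also regarded as a permutation of $\{l(i-1)+1,\dots,l(i+1)\}$. For $l\mid m$, $1\le l<m$, and a family $t=(t^i_q)$ with $t^i_q\in\bigtriangledown_{m/l}$, put $$\phi_{m,l,t}(\sigma_i)=A^{m/l}_1\cdots A^{m/l}_{(i-1)l}\cdot C^{\psi_l(\sigma_i),m/l}_{t^i_{(i-1)l+1},\dots,t^i_{(i+1)l}}\cdot A^{m/l}_{(i+1)l+1}\cdots A^{m/l}_{kl}\in S_{mk}.$$ *)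

theory Defs
  imports "HOL-Algebra.Sym_Groups"
begin

section \<open>Groups given by generators and relations\<close>

text \<open>A letter \<open>(True, x)\<close> stands for the generator \<open>x\<close>, a letter \<open>(False, x)\<close> for its
  formal inverse. A relation \<open>(u, v) \<in> R\<close> stands for \<open>u = v\<close>.\<close>

type_synonym 'a word = "(bool \<times> 'a) list"

definition words :: "'a set \<Rightarrow> 'a word set"
  where "words S = lists (UNIV \<times> S)"

inductive word_eq :: "'a set \<Rightarrow> ('a word \<times> 'a word) set \<Rightarrow> 'a word \<Rightarrow> 'a word \<Rightarrow> bool"
  for S R where
  refl: "u \<in> words S \<Longrightarrow> word_eq S R u u"
| sym: "word_eq S R u v \<Longrightarrow> word_eq S R v u"
| trans: "word_eq S R u v \<Longrightarrow> word_eq S R v w \<Longrightarrow> word_eq S R u w"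
| cancel: "u \<in> words S \<Longrightarrow> v \<in> words S \<Longrightarrow> x \<in> S \<Longrightarrow>
    word_eq S R (u @ [(b, x), (\<not> b, x)] @ v) (u @ v)"
| rel: "(r, s) \<in> R \<Longrightarrow> r \<in> words S \<Longrightarrow> s \<in> words S \<Longrightarrow> u \<in> words S \<Longrightarrow> v \<in> words S \<Longrightarrow>
    word_eq S R (u @ r @ v) (u @ s @ v)"

definition word_rel :: "'a set \<Rightarrow> ('a word \<times> 'a word) set \<Rightarrow> ('a word \<times> 'a word) set"
  where "word_rel S R = {(u, v). word_eq S R u v}"

definition word_class :: "'a set \<Rightarrow> ('a word \<times> 'a word) set \<Rightarrow> 'a word \<Rightarrow> 'a word set"
  where "word_class S R u = word_rel S R `` {u}"

definition presented_group :: "'a set \<Rightarrow> ('a word \<times> 'a word) set \<Rightarrow> 'a word set monoid"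
  where "presented_group S R =
    \<lparr> carrier = words S // word_rel S R,
      mult = (\<lambda>X Y. \<Union>u\<in>X. \<Union>v\<in>Y. word_class S R (u @ v)),
      one = word_class S R [] \<rparr>"

lemma words_Nil [simp]: "[] \<in> words S"
  by (simp add: words_def)

lemma words_Cons [simp]: "a # u \<in> words S \<longleftrightarrow> snd a \<in> S \<and> u \<in> words S"
  by (cases a) (auto simp: words_def)

lemma words_append [simp]: "u @ v \<in> words S \<longleftrightarrow> u \<in> words S \<and> v \<in> words S"
  by (auto simp: words_def)

lemma word_eq_words:
  assumes "word_eq S R u v"
  shows "u \<in> words S" "v \<in> words S"
  using assms by (induction, auto)

lemma word_eq_context:
  assumes "word_eq S R u v" "x \<in> words S" "y \<in> words S"
  shows "word_eq S R (x @ u @ y) (x @ v @ y)"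
  using assms
proof (induction)
  case (cancel u v z b)
  then show ?case
    using word_eq.cancel[of "x @ u" S "v @ y" z R b] by simp
next
  case (rel r s u v)
  then show ?case
    using word_eq.rel[of r s R S "x @ u" "v @ y"] by simp
next
  case (refl u)
  then show ?case by (simp add: word_eq.refl)
next
  case (sym u v)
  then show ?case by (simp add: word_eq.sym)
next
  case (trans u v w)
  then show ?case by (metis word_eq.trans)
qed

lemma word_eq_append:
  assumes "word_eq S R u u'" "word_eq S R v v'"
  shows "word_eq S R (u @ v) (u' @ v')"
proof (rule word_eq.trans)
  show "word_eq S R (u @ v) (u' @ v)"
    using word_eq_context[OF assms(1), of "[]" v] word_eq_words[OF assms(2)] by simp
  show "word_eq S R (u' @ v) (u' @ v')"
    using word_eq_context[OF assms(2), of u' "[]"] word_eq_words[OF assms(1)] by simp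
qed

lemma equiv_word_rel: "equiv (words S) (word_rel S R)"
proof (rule equivI)
  show "word_rel S R \<subseteq> words S \<times> words S"
    by (auto simp: word_rel_def dest: word_eq_words)
  show "refl_on (words S) (word_rel S R)"
    by (simp add: refl_on_def word_rel_def word_eq.refl)
  show "sym_on UNIV (word_rel S R)"
    by (simp add: sym_def word_rel_def word_eq.sym)
  show "trans_on UNIV (word_rel S R)"
    unfolding trans_def word_rel_def by (blast intro: word_eq.trans)
qed

lemma word_class_eq_iff:
  assumes "u \<in> words S" "v \<in> words S"
  shows "word_class S R u = word_class S R v \<longleftrightarrow> word_eq S R u v"
  using eq_equiv_class_iff[OF equiv_word_rel assms] by (simp add: word_class_def word_rel_def)

lemma presented_group_carrier:
  "carrier (presented_group S R) = word_class S R ` words S"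
  by (auto simp: presented_group_def quotient_def word_class_def)

lemma presented_group_one: "\<one>\<^bsub>presented_group S R\<^esub> = word_class S R []"
  by (simp add: presented_group_def)

lemma presented_group_mult:
  assumes "u \<in> words S" "v \<in> words S"
  shows "word_class S R u \<otimes>\<^bsub>presented_group S R\<^esub> word_class S R v = word_class S R (u @ v)"
proof -
  have "word_class S R (u' @ v') = word_class S R (u @ v)"
    if "word_eq S R u u'" "word_eq S R v v'" for u' v'
    using word_eq.sym[OF word_eq_append[OF that]] word_eq_words[OF that(1)] word_eq_words[OF that(2)]
    by (simp add: word_class_eq_iff)
  moreover have "u \<in> word_class S R u" "v \<in> word_class S R v"
    using assms by (simp_all add: word_class_def word_rel_def word_eq.refl)
  moreover have "word_eq S R u u'" if "u' \<in> word_class S R u" for u u'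
    using that by (simp add: word_class_def word_rel_def)
  ultimately have "(\<Union>u'\<in>word_class S R u. \<Union>v'\<in>word_class S R v. word_class S R (u' @ v')) =
      word_class S R (u @ v)"
    by blast
  then show ?thesis
    by (simp add: presented_group_def)
qed

definition inverse_word :: "'a word \<Rightarrow> 'a word"
  where "inverse_word u = rev (map (\<lambda>(b, x). (\<not> b, x)) u)"

lemma inverse_word_words: "u \<in> words S \<Longrightarrow> inverse_word u \<in> words S"
  by (auto simp: words_def inverse_word_def)

lemma inverse_word_left: "u \<in> words S \<Longrightarrow> word_eq S R (inverse_word u @ u) []"
proof (induction u)
  case (Cons a u)
  obtain b x where a: "a = (b, x)" by (cases a)
  have "word_eq S R (inverse_word u @ [(\<not> b, x), (\<not> \<not> b, x)] @ u) (inverse_word u @ u)"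
    using Cons.prems a by (intro word_eq.cancel) (auto simp: inverse_word_words)
  moreover have "word_eq S R (inverse_word u @ u) []"
    using Cons by simp
  ultimately show ?case
    using word_eq.trans by (fastforce simp: a inverse_word_def)
qed (auto simp: inverse_word_def intro: word_eq.refl)

lemma group_presented_group: "group (presented_group S R)"
proof (rule groupI)
  fix X assume "X \<in> carrier (presented_group S R)"
  then obtain u where u: "u \<in> words S" "X = word_class S R u"
    by (auto simp: presented_group_carrier)
  show "\<exists>Y\<in>carrier (presented_group S R). Y \<otimes>\<^bsub>presented_group S R\<^esub> X = \<one>\<^bsub>presented_group S R\<^esub>"
    using u inverse_word_words[OF u(1)] inverse_word_left[OF u(1)]
    by (intro bexI[of _ "word_class S R (inverse_word u)"])
       (auto simp: presented_group_carrier presented_group_one presented_group_mult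
          word_class_eq_iff)
qed (auto simp: presented_group_carrier presented_group_one presented_group_mult)

section \<open>Braid groups\<close>

definition braid_relations :: "nat \<Rightarrow> (nat word \<times> nat word) set"
  where "braid_relations k =
    {([(True, i), (True, j)], [(True, j), (True, i)]) | i j.
       i \<in> {1..<k} \<and> j \<in> {1..<k} \<and> (i + 2 \<le> j \<or> j + 2 \<le> i)} \<union>
    {([(True, i), (True, i + 1), (True, i)], [(True, i + 1), (True, i), (True, i + 1)]) | i.
       i \<in> {1..<k} \<and> i + 1 \<in> {1..<k}}"

definition braid_group :: "nat \<Rightarrow> nat word set monoid"
  where "braid_group k = presented_group {1..<k} (braid_relations k)"

definition braid_gen :: "nat \<Rightarrow> nat \<Rightarrow> nat word set"
  where "braid_gen k i = word_class {1..<k} (braid_relations k) [(True, i)]"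

lemma group_braid_group: "group (braid_group k)"
  by (simp add: braid_group_def group_presented_group)

lemma braid_gen_carrier: "i \<in> {1..<k} \<Longrightarrow> braid_gen k i \<in> carrier (braid_group k)"
  by (auto simp: braid_group_def braid_gen_def presented_group_carrier)

lemma braid_gen_commute:
  assumes "i \<in> {1..<k}" "j \<in> {1..<k}" "i + 2 \<le> j \<or> j + 2 \<le> i"
  shows "braid_gen k i \<otimes>\<^bsub>braid_group k\<^esub> braid_gen k j =
    braid_gen k j \<otimes>\<^bsub>braid_group k\<^esub> braid_gen k i"
proof -
  have "word_eq {1..<k} (braid_relations k) [(True, i), (True, j)] [(True, j), (True, i)]"
    using assms word_eq.rel[of "[(True, i), (True, j)]" "[(True, j), (True, i)]"
        "braid_relations k" "{1..<k}" "[]" "[]"]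
    by (auto simp: braid_relations_def)
  then show ?thesis
    using assms by (simp add: braid_group_def braid_gen_def presented_group_mult word_class_eq_iff)
qed

lemma braid_gen_braid:
  assumes "i \<in> {1..<k}" "i + 1 \<in> {1..<k}"
  shows "braid_gen k i \<otimes>\<^bsub>braid_group k\<^esub> braid_gen k (i + 1) \<otimes>\<^bsub>braid_group k\<^esub> braid_gen k i =
    braid_gen k (i + 1) \<otimes>\<^bsub>braid_group k\<^esub> braid_gen k i \<otimes>\<^bsub>braid_group k\<^esub> braid_gen k (i + 1)"
proof -
  have "word_eq {1..<k} (braid_relations k) [(True, i), (True, i + 1), (True, i)]
      [(True, i + 1), (True, i), (True, i + 1)]"
    using assms word_eq.rel[of "[(True, i), (True, i + 1), (True, i)]"
        "[(True, i + 1), (True, i), (True, i + 1)]" "braid_relations k" "{1..<k}" "[]" "[]"]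
    by (auto simp: braid_relations_def)
  then show ?thesis
    using assms by (simp add: braid_group_def braid_gen_def presented_group_mult word_class_eq_iff)
qed

section \<open>Conjugate homomorphisms\<close>

definition conjugate_homs ::
  "('a, 'c) monoid_scheme \<Rightarrow> ('b, 'd) monoid_scheme \<Rightarrow> ('a \<Rightarrow> 'b) \<Rightarrow> ('a \<Rightarrow> 'b) \<Rightarrow> bool"
  where "conjugate_homs G H \<phi> \<psi> \<longleftrightarrow>
    (\<exists>h\<in>carrier H. \<forall>g\<in>carrier G. \<psi> g = inv\<^bsub>H\<^esub> h \<otimes>\<^bsub>H\<^esub> \<phi> g \<otimes>\<^bsub>H\<^esub> h)"

section \<open>The permutations\<close>

text \<open>All permutations are functions on \<^typ>\<open>nat\<close> that are the identity outside the set they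
  permute. The products below are taken with \<open>\<circ>\<close>, which is the multiplication of
  \<^const>\<open>sym_group\<close>. The set \<open>{0, \<dots>, n - 1}\<close> is \<^term>\<open>{..<n::nat}\<close>, and the residue of \<open>a\<close>
  modulo \<open>n\<close> is \<open>a mod n\<close>; only non-negative \<open>a\<close> occur.\<close>

definition pt :: "nat \<Rightarrow> nat \<Rightarrow> nat \<Rightarrow> nat"
  where "pt n i q = 1 + n * (i - 1) + q"

definition A_cycle :: "nat \<Rightarrow> nat \<Rightarrow> nat \<Rightarrow> nat"
  where "A_cycle n i = cycle_of_list [1 + n * (i - 1)..<n * i + 1]"

text \<open>For \<open>n \<ge> 1\<close>, every \<open>x \<ge> 1\<close> is \<open>pt n i q\<close> for exactly one \<open>i \<ge> 1\<close> and \<open>q < n\<close>, namely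
  \<open>i = (x - 1) div n + 1\<close> and \<open>q = (x - 1) mod n\<close>. The permutation \<open>C_perm \<sigma> n j r t\<close> moves only
  points with index \<open>i\<close> in \<open>{j, \<dots>, j + r - 1}\<close>.\<close>

definition C_perm ::
  "(nat \<Rightarrow> nat) \<Rightarrow> nat \<Rightarrow> nat \<Rightarrow> nat \<Rightarrow> (nat \<Rightarrow> nat) \<Rightarrow> nat \<Rightarrow> nat"
  where "C_perm \<sigma> n j r t x =
    (if x \<in> {n * (j - 1) + 1..n * (j + r - 1)} then
       let i = (x - 1) div n + 1; q = (x - 1) mod n in pt n (\<sigma> i) ((q + t (\<sigma> i)) mod n)
     else x)"

lemma C_perm_pt:
  assumes "1 \<le> j" "i \<in> {j..<j + r}" "q < n"
  shows "C_perm \<sigma> n j r t (pt n i q) = pt n (\<sigma> i) ((q + t (\<sigma> i)) mod n)"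
proof -
  have "n * (j - 1) \<le> n * (i - 1)" "n * i \<le> n * (j + r - 1)"
    by (rule mult_le_mono2, use assms in auto)+
  moreover have "n * i = n * (i - 1) + n"
    using assms by (cases i) auto
  ultimately have "pt n i q \<in> {n * (j - 1) + 1..n * (j + r - 1)}"
    using assms unfolding pt_def atLeastAtMost_iff by linarith
  then show ?thesis
    using assms by (simp add: C_perm_def pt_def Let_def)
qed

definition psi_cycle :: "nat \<Rightarrow> nat \<Rightarrow> nat \<Rightarrow> nat"
  where "psi_cycle l i =
    cycle_of_list (concat (map (\<lambda>q. [pt l i q, pt l (i + 1) q]) [0..<l]))"

definition A_prod :: "nat \<Rightarrow> nat list \<Rightarrow> nat \<Rightarrow> nat"
  where "A_prod n is = foldr (\<lambda>i f. A_cycle n i \<circ> f) is id"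

text \<open>\<open>t i q\<close> is the entry of the family \<open>t\<close> with upper index \<open>i\<close> and lower index \<open>q\<close>. Its values
  are used only for \<open>1 \<le> i < k\<close> and \<open>(i - 1) * l + 1 \<le> q \<le> (i + 1) * l\<close>.\<close>

definition phi_perm :: "nat \<Rightarrow> nat \<Rightarrow> nat \<Rightarrow> (nat \<Rightarrow> nat \<Rightarrow> nat) \<Rightarrow> nat \<Rightarrow> nat \<Rightarrow> nat"
  where "phi_perm k m l t i =
    A_prod (m div l) [1..<(i - 1) * l + 1] \<circ>
    C_perm (psi_cycle l i) (m div l) ((i - 1) * l + 1) (2 * l) (t i) \<circ>
    A_prod (m div l) [(i + 1) * l + 1..<k * l + 1]"

end

(* Write a point as (j, r, q), with block j, r modulo l and q modulo n = m / l, and abbreviate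
   a_i(r) = t i (pt l i r) and b_i(r) = t i (pt l (i + 1) r). The braid relation of sigma_i and
   sigma_(i+1) at (i + 1, r, 0) says a_i(r+1) + b_i(r+1) = b_(i+1)(r) + a_(i+1)(r+1) modulo n.
   Conjugation by a shift (j, r, q) -> (j, r, q + c_j(r)) replaces b_i(r) by
   b_i(r) + c_i(r) - c_(i+1)(r) and a_i(r+1) by a_i(r+1) + c_(i+1)(r) - c_i(r+1). Taking
   c_(i+1)(r) = c_i(r) + b_i(r) kills all b_i; the braid relations then make the new a_i
   independent of i, and c_1 can be chosen to kill all its entries but the one at r = 0. *)

theory Submission
  imports Defs "HOL-Number_Theory.Cong"
begin

section \<open>Coordinates of points and the action of cycles on them\<close>

lemma cycle_of_list_nth:
  assumes "cycle xs" "j < length xs"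
  shows "cycle_of_list xs (xs ! j) = xs ! (Suc j mod length xs)"
proof -
  \<comment> \<open>Applying the cycle to every entry of its own list rotates that list by one
    place, so the image of entry \<open>j\<close> can be read off the rotated list.\<close>
  have "map (cycle_of_list xs) xs ! j = rotate 1 xs ! j"
    using cyclic_rotation[OF assms(1), of 1] by simp
  then show ?thesis
    using assms(2) nth_rotate[of j xs 1] by simp
qed

lemma pt_index:
  assumes "1 \<le> i" "q < n"
  shows "(pt n i q - 1) div n + 1 = i" "(pt n i q - 1) mod n = q"
  using assms by (auto simp: pt_def)

lemma pt_eq_iff:
  assumes "1 \<le> i" "1 \<le> i'" "q < n" "q' < n"
  shows "pt n i q = pt n i' q' \<longleftrightarrow> i = i' \<and> q = q'"
  using assms pt_index by metis

lemma pt_cases: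
  assumes "1 \<le> n" "1 \<le> x"
  obtains i q where "1 \<le> i" "q < n" "x = pt n i q"
proof
  show "1 \<le> (x - 1) div n + 1" "(x - 1) mod n < n"
    using assms by auto
  show "x = pt n ((x - 1) div n + 1) ((x - 1) mod n)"
    using assms by (simp add: pt_def)
qed

text \<open>Block \<open>N\<close> of size \<open>n\<close> ends at \<open>N * n\<close>. This turns
  bounds on numbers into bounds on block indices; with \<open>l\<close> in the place of
  \<open>n\<close> it locates the indices \<open>pt l j r\<close> relative to the ranges of the
  factors of \<open>phi_perm\<close>.\<close>

lemma pt_le_iff:
  assumes "1 \<le> i" "q < n"
  shows "pt n i q \<le> N * n \<longleftrightarrow> i \<le> N"
proof
  assume "i \<le> N"
  then have "i * n \<le> N * n" by (rule mult_le_mono1)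
  moreover have "pt n i q \<le> i * n"
    using assms by (cases i) (auto simp: pt_def algebra_simps)
  ultimately show "pt n i q \<le> N * n" by (rule order_trans[rotated])
next
  assume *: "pt n i q \<le> N * n"
  show "i \<le> N"
  proof (rule ccontr)
    assume "\<not> i \<le> N"
    then have "N * n \<le> (i - 1) * n" by (intro mult_le_mono1) auto
    with * show False unfolding pt_def mult.commute[of n] by linarith
  qed
qed

lemma pt_pos: "0 < pt n i q"
  by (simp add: pt_def)

lemma A_cycle_pt:
  assumes "1 \<le> i" "1 \<le> j" "q < n"
  shows "A_cycle n i (pt n j q) = pt n j (if i = j then (q + 1) mod n else q)"
proof -
  define xs where "xs = [1 + n * (i - 1)..<n * i + 1]"
  have len: "length xs = n"
    using assms by (cases i) (auto simp: xs_def)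
  have nth: "xs ! q = pt n i q" if "q < n" for q
    using that len by (simp add: xs_def pt_def del: upt_Suc)
  have A: "A_cycle n i = cycle_of_list xs"
    by (simp only: A_cycle_def xs_def)
  show ?thesis
  proof (cases "i = j")
    case True
    have "cycle_of_list xs (xs ! q) = xs ! (Suc q mod n)"
      using cycle_of_list_nth[of xs q] assms(3) len by (simp add: xs_def)
    then show ?thesis
      using True assms(3) unfolding A by (simp add: nth)
  next
    case False
    have "pt n j q \<notin> set xs"
    proof
      assume "pt n j q \<in> set xs"
      then obtain r where "r < n" "pt n j q = pt n i r"
        using len nth by (metis in_set_conv_nth)
      then show False
        using assms False by (simp add: pt_eq_iff)
    qed
    then show ?thesis
      using False unfolding A by (simp add: id_outside_supp)
  qed
qed

text \<open>The cycles have disjoint supports and each occurs once, so at most one factor moves a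
  given point.\<close>

lemma A_prod_pt:
  assumes "distinct is" "0 \<notin> set is" "1 \<le> j" "q < n"
  shows "A_prod n is (pt n j q) = pt n j (if j \<in> set is then (q + 1) mod n else q)"
  using assms
proof (induction "is")
  case (Cons i "is")
  then have "A_prod n (i # is) (pt n j q) =
      A_cycle n i (pt n j (if j \<in> set is then (q + 1) mod n else q))"
    by (simp add: A_prod_def)
  with Cons.prems show ?case
    by (auto simp: A_cycle_pt)
qed (simp add: A_prod_def)

text \<open>For \<open>n \<ge> 1\<close> every positive number is some \<open>pt n i q\<close>; 0 is
  the one argument that these coordinates miss, so it needs its own treatment when functions on all
  naturals are compared.\<close>

lemma A_prod_zero: "A_prod n is 0 = 0"
  by (induction "is") (auto simp: A_prod_def A_cycle_def intro!: id_outside_supp)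

text \<open>Indexing the interleaved list by position makes the successor rule for cycles
  applicable: parity selects the block, half the position the residue.\<close>

lemma concat_pairs:
  "concat (map (\<lambda>q. [f q, g q]) [0..<l]) =
   map (\<lambda>j. if even j then f (j div 2) else g (j div 2)) [0..<2 * l]"
  by (induction l) auto

lemma psi_cycle_pt:
  assumes "1 \<le> i" "r < l"
  shows "psi_cycle l i (pt l i r) = pt l (i + 1) r"
    and "psi_cycle l i (pt l (i + 1) r) = pt l i ((r + 1) mod l)"
proof -
  define f where "f j = (if even j then pt l i (j div 2) else pt l (i + 1) (j div 2))" for j
  define xs where "xs = map f [0..<2 * l]"
  have xs: "psi_cycle l i = cycle_of_list xs"
    unfolding psi_cycle_def concat_pairs xs_def f_def ..
  have "inj_on f {0..<2 * l}"
  proof (rule inj_onI)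
    fix a b assume "a \<in> {0..<2 * l}" "b \<in> {0..<2 * l}" "f a = f b"
    moreover from this have "a div 2 < l" "b div 2 < l" by auto
    ultimately have "even a \<longleftrightarrow> even b" "a div 2 = b div 2"
      using assms(1) by (auto simp: f_def pt_eq_iff split: if_splits)
    then show "a = b"
      by (metis even_iff_mod_2_eq_zero div_mult_mod_eq not_mod_2_eq_1_eq_0)
  qed
  then have "cycle xs"
    by (simp add: xs_def distinct_map)
  from cycle_of_list_nth[OF this]
  have step: "psi_cycle l i (f j) = f (Suc j mod (2 * l))" if "j < 2 * l" for j
    using that by (simp add: xs xs_def)
  show "psi_cycle l i (pt l i r) = pt l (i + 1) r"
    using step[of "2 * r"] assms by (simp add: f_def)
  \<comment> \<open>Residue \<open>r\<close> of the upper block sits at position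
    \<open>2 * r + 1\<close>. The wrap-around of positions from \<open>2 * l - 1\<close> to 0
    becomes the reduction of \<open>r + 1\<close> modulo \<open>l\<close>.\<close>
  have "Suc (2 * r + 1) mod (2 * l) = 2 * ((r + 1) mod l)"
    using mult_mod_right[of 2 "r + 1" l] by simp
  then show "psi_cycle l i (pt l (i + 1) r) = pt l i ((r + 1) mod l)"
    using step[of "2 * r + 1"] assms by (simp add: f_def)
qed

lemma C_perm_outside:
  assumes "1 \<le> j" "1 \<le> i" "i \<notin> {j..<j + r}" "q < n"
  shows "C_perm \<sigma> n j r t (pt n i q) = pt n i q"
proof -
  have "pt n i q \<le> (j - 1) * n \<or> \<not> pt n i q \<le> (j + r - 1) * n"
    using assms by (subst (1 2) pt_le_iff) auto
  then show ?thesis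
    by (auto simp: C_perm_def mult.commute)
qed

lemma C_perm_zero: "C_perm \<sigma> n j r t 0 = 0"
  by (simp add: C_perm_def)

text \<open>With \<open>id\<close> as block permutation, block \<open>i\<close> is rotated by
  \<open>c i\<close>; such maps serve as conjugators. Cancelling \<open>c i\<close> modulo
  \<open>n\<close> gives injectivity, and finiteness then gives bijectivity.\<close>

lemma C_perm_id_permutes:
  "C_perm id n 1 N c permutes {1..N * n}"
proof (cases "n = 0")
  case False
  let ?h = "C_perm id n 1 N c"
  have dec: "\<exists>i q. i \<in> {1..N} \<and> q < n \<and> x = pt n i q \<and> ?h x = pt n i ((q + c i) mod n)"
    if x: "x \<in> {1..N * n}" for x
  proof -
    obtain i q where "1 \<le> i" "q < n" "x = pt n i q"
      using pt_cases[of n x] False x by auto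
    moreover from this x have "i \<le> N"
      using pt_le_iff[of i q n N] by auto
    ultimately show ?thesis
      using C_perm_pt[of 1 i N q n id c] by auto
  qed
  have "inj_on ?h {1..N * n}"
  proof (rule inj_onI)
    fix x y assume xy: "x \<in> {1..N * n}" "y \<in> {1..N * n}" "?h x = ?h y"
    obtain i q where i: "i \<in> {1..N}" "q < n" "x = pt n i q" "?h x = pt n i ((q + c i) mod n)"
      using dec[OF xy(1)] by auto
    obtain j r where j: "j \<in> {1..N}" "r < n" "y = pt n j r" "?h y = pt n j ((r + c j) mod n)"
      using dec[OF xy(2)] by auto
    have "i = j" "(q + c i) mod n = (r + c j) mod n"
      using i j xy(3) False pt_eq_iff[of i j "(q + c i) mod n" n "(r + c j) mod n"] by auto
    then have "i = j" "q mod n = r mod n"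
      by (auto simp flip: cong_def simp: cong_add_rcancel_nat)
    with i j show "x = y" by simp
  qed
  moreover have "?h ` {1..N * n} \<subseteq> {1..N * n}"
  proof
    fix y assume "y \<in> ?h ` {1..N * n}"
    then obtain i q where "i \<in> {1..N}" "y = pt n i ((q + c i) mod n)"
      using dec by force
    then show "y \<in> {1..N * n}"
      using pt_le_iff[of i "(q + c i) mod n" n N] False pt_pos[of n i "(q + c i) mod n"] by auto
  qed
  ultimately have "bij_betw ?h {1..N * n} {1..N * n}"
    by (simp add: bij_betw_def endo_inj_surj)
  then show ?thesis
    by (rule bij_imp_permutes) (auto simp: C_perm_def mult.commute)
qed (auto simp: C_perm_def fun_eq_iff permutes_def)

section \<open>Action of the generators on triples (j, r, q), encoded as
  \<open>pt n (pt l j r) q\<close>\<close>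

lemma phi_perm_zero: "phi_perm k m l t i 0 = 0"
  by (simp add: phi_perm_def A_prod_zero C_perm_zero)

lemma phi_perm_outside:
  assumes "i \<in> {1..<k}" "k * l < x" "q < n" "1 \<le> l"
  shows "phi_perm k (n * l) l t i (pt n x q) = pt n x q"
proof -
  have "(i - 1) * l \<le> k * l" "(i + 1) * l \<le> k * l"
    by (rule mult_le_mono1, use assms in force)+
  moreover have "(i + 1) * l = (i - 1) * l + 2 * l"
    using assms by (cases i) auto
  ultimately show ?thesis
    using assms by (simp add: phi_perm_def A_prod_pt C_perm_outside)
qed

text \<open>Away from the blocks \<open>i\<close> and \<open>i + 1\<close> the index
  \<open>pt l j r\<close> lies outside the range of the \<open>C_perm\<close> factor and in exactly
  one of the two ranges of cycles, so \<open>q\<close> advances by one.\<close>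

lemma phi_perm_other:
  assumes "i \<in> {1..<k}" "j \<in> {1..k} - {i, i + 1}" "r < l" "q < n"
  shows "phi_perm k (n * l) l t i (pt n (pt l j r) q) = pt n (pt l j r) ((q + 1) mod n)"
proof -
  have "(i + 1) * l = (i - 1) * l + 2 * l"
    using assms by (cases i) auto
  moreover have "pt l j r \<le> (i - 1) * l \<longleftrightarrow> j \<le> i - 1" "pt l j r \<le> (i + 1) * l \<longleftrightarrow> j \<le> i + 1"
    "pt l j r \<le> k * l"
    by (subst pt_le_iff; use assms in auto)+
  ultimately show ?thesis
    using assms pt_pos[of l j r]
    by (cases "j < i") (auto simp: phi_perm_def A_prod_pt C_perm_outside)
qed

text \<open>Only the \<open>C_perm\<close> factor acts. The left product of cycles is applied to the
  image, which is why the image index must be known to lie in the two active blocks as well.\<close>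

lemma phi_perm_block:
  assumes "i \<in> {1..<k}" "j \<in> {i, i + 1}" "r < l" "q < n"
    and "psi_cycle l i (pt l j r) = pt l j' r'" "j' \<in> {i, i + 1}" "r' < l"
  shows "phi_perm k (n * l) l t i (pt n (pt l j r) q) =
    pt n (pt l j' r') ((q + t i (pt l j' r')) mod n)"
proof -
  have "(i + 1) * l = (i - 1) * l + 2 * l"
    using assms by (cases i) auto
  moreover have "\<not> pt l j r \<le> (i - 1) * l" "pt l j r \<le> (i + 1) * l"
    "\<not> pt l j' r' \<le> (i - 1) * l" "pt l j' r' \<le> (i + 1) * l"
    using assms by (subst pt_le_iff; force)+
  ultimately show ?thesis
    using assms by (auto simp: phi_perm_def A_prod_pt C_perm_pt pt_pos)
qed

lemma phi_perm_lower:
  assumes "i \<in> {1..<k}" "r < l" "q < n"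
  shows "phi_perm k (n * l) l t i (pt n (pt l i r) q) =
    pt n (pt l (i + 1) r) ((q + t i (pt l (i + 1) r)) mod n)"
  by (rule phi_perm_block) (use assms psi_cycle_pt[of i r l] in auto)

lemma phi_perm_upper:
  assumes "i \<in> {1..<k}" "r < l" "q < n"
  shows "phi_perm k (n * l) l t i (pt n (pt l (i + 1) r) q) =
    pt n (pt l i ((r + 1) mod l)) ((q + t i (pt l i ((r + 1) mod l))) mod n)"
  by (rule phi_perm_block) (use assms psi_cycle_pt[of i r l] in auto)

section \<open>The braid relation and conjugation by shifts, as congruences\<close>

lemma braid_phi_perm_cong:
  assumes "i \<in> {1..<k}" "i + 1 \<in> {1..<k}" "r < l" "1 \<le> n"
    and braid: "phi_perm k (n * l) l t i \<circ> phi_perm k (n * l) l t (i + 1) \<circ> phi_perm k (n * l) l t i =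
      phi_perm k (n * l) l t (i + 1) \<circ> phi_perm k (n * l) l t i \<circ> phi_perm k (n * l) l t (i + 1)"
  defines "r' \<equiv> (r + 1) mod l"
  shows "[t i (pt l i r') + t i (pt l (i + 1) r') =
    t (i + 1) (pt l (i + 1 + 1) r) + t (i + 1) (pt l (i + 1) r')] (mod n)"
proof -
  let ?\<phi> = "phi_perm k (n * l) l t"
  \<comment> \<open>From here one side of the braid relation runs through block \<open>i\<close>,
    the other through block \<open>i + 2\<close>; both end in block \<open>i + 1\<close> at residue
    \<open>r'\<close>, so that the last coordinates can be compared.\<close>
  let ?x = "pt n (pt l (i + 1) r) 0"
  have r': "r' < l"
    using assms(3) by (simp add: r'_def)
  have n: "0 < n" "y mod n < n" for y
    using assms(4) by auto
  have "?\<phi> i (?\<phi> (i + 1) (?\<phi> i ?x)) =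
      pt n (pt l (i + 1) r') ((t i (pt l i r') + 1 + t i (pt l (i + 1) r')) mod n)"
    using assms(1-3) r' n
    by (simp add: phi_perm_upper[of i] phi_perm_lower[of i] phi_perm_other mod_simps
        flip: r'_def del: One_nat_def add_Suc_right add_Suc)
  moreover have "?\<phi> (i + 1) (?\<phi> i (?\<phi> (i + 1) ?x)) =
      pt n (pt l (i + 1) r') ((t (i + 1) (pt l (i + 1 + 1) r) + 1 + t (i + 1) (pt l (i + 1) r')) mod n)"
    using assms(1-3) r' n
    by (simp add: phi_perm_upper[of "i + 1"] phi_perm_lower[of "i + 1"] phi_perm_other mod_simps
        flip: r'_def del: One_nat_def add_Suc_right add_Suc)
  ultimately have "[t i (pt l i r') + 1 + t i (pt l (i + 1) r') =
      t (i + 1) (pt l (i + 1 + 1) r) + 1 + t (i + 1) (pt l (i + 1) r')] (mod n)"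
    using fun_cong[OF braid, of ?x] n by (simp add: pt_eq_iff Suc_le_eq pt_pos cong_def)
  \<comment> \<open>The middle factor on either side meets a block on which it is the rotation by
    one; this common 1 cancels.\<close>
  then have "[t i (pt l i r') + t i (pt l (i + 1) r') + 1 =
      t (i + 1) (pt l (i + 1 + 1) r) + t (i + 1) (pt l (i + 1) r') + 1] (mod n)"
    by (simp add: ac_simps)
  then show ?thesis
    by (simp only: cong_add_rcancel_nat)
qed

text \<open>The map \<open>h\<close> adds \<open>c j r\<close> to the last coordinate of (j, r, q),
  recovering \<open>j\<close> and \<open>r\<close> from the index \<open>x\<close>. In the two
  active blocks the assumed congruences say that the last coordinates agree. In the other blocks up
  to \<open>k\<close> both maps are rotations, which commute, and all remaining points are fixed by
  both.\<close>

lemma phi_perm_intertwine: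
  fixes c :: "nat \<Rightarrow> nat \<Rightarrow> nat"
  assumes "i \<in> {1..<k}" "1 \<le> l" "1 \<le> n"
    and lower: "\<And>r. r < l \<Longrightarrow> [c i r + t i (pt l (i + 1) r) = c (i + 1) r + t' i (pt l (i + 1) r)] (mod n)"
    and upper: "\<And>r. r < l \<Longrightarrow> [c (i + 1) r + t i (pt l i ((r + 1) mod l)) =
      c i ((r + 1) mod l) + t' i (pt l i ((r + 1) mod l))] (mod n)"
  defines "h \<equiv> C_perm id n 1 (k * l) (\<lambda>x. c ((x - 1) div l + 1) ((x - 1) mod l))"
  shows "h \<circ> phi_perm k (n * l) l t' i = phi_perm k (n * l) l t i \<circ> h"
proof
  fix y
  let ?\<phi> = "phi_perm k (n * l) l t i" and ?\<phi>' = "phi_perm k (n * l) l t' i"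
  have n: "y mod n < n" for y
    using assms(3) by auto
  have h: "h (pt n (pt l j r) q) = pt n (pt l j r) ((q + c j r) mod n)"
    if "j \<in> {1..k}" "r < l" "q < n" for j r q
  proof -
    have "pt l j r \<in> {1..<1 + k * l}"
      using that pt_le_iff[of j r l k] pt_pos[of l j r] by auto
    then show ?thesis
      unfolding h_def using that by (subst C_perm_pt) (auto simp: pt_index simp del: One_nat_def)
  qed
  consider "y = 0" | x q where "k * l < x" "q < n" "y = pt n x q"
    | x q where "1 \<le> x" "x \<le> k * l" "q < n" "y = pt n x q"
    using pt_cases[of n y] assms(3) by (metis less_one not_le)
  then show "(h \<circ> ?\<phi>') y = (?\<phi> \<circ> h) y"
  proof cases
    case 1
    then show ?thesis
      by (simp add: h_def C_perm_zero phi_perm_zero)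
  next
    case 2
    then show ?thesis
      using assms(1,2) by (simp add: h_def C_perm_outside phi_perm_outside)
  next
    case 3
    obtain j r where jr: "1 \<le> j" "r < l" "x = pt l j r"
      using pt_cases[of l x] 3 assms(2) by auto
    then have y: "y = pt n (pt l j r) q" and j: "j \<in> {1..k}"
      using 3 pt_le_iff[of j r l k] by auto
    consider "j = i" | "j = i + 1" | "j \<in> {1..k} - {i, i + 1}"
      using j by auto
    then show ?thesis
    proof cases
      case 1
      have "[q + (c i r + t i (pt l (i + 1) r)) = q + (c (i + 1) r + t' i (pt l (i + 1) r))] (mod n)"
        by (intro cong_add cong_refl lower jr)
      then show ?thesis
        using 1 y jr \<open>q < n\<close> assms(1) n
        by (simp add: phi_perm_lower h mod_simps cong_def add.assoc add.commute add.left_commute)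
    next
      case 2
      let ?r = "(r + 1) mod l"
      have "[q + (c (i + 1) r + t i (pt l i ?r)) = q + (c i ?r + t' i (pt l i ?r))] (mod n)"
        by (intro cong_add cong_refl upper jr)
      moreover have "?r < l"
        using assms(2) by simp
      ultimately show ?thesis
        using 2 y jr \<open>q < n\<close> assms(1) n phi_perm_upper[of i k r l _ n]
        by (simp add: h mod_simps cong_def add.assoc add.commute add.left_commute)
    next
      case 3
      then show ?thesis
        using y jr \<open>q < n\<close> assms(1) n by (simp add: phi_perm_other h mod_simps add.assoc add.commute add.left_commute)
    qed
  qed
qed

section \<open>Conjugate homomorphisms and the choice of the shift\<close>

lemma (in group) conjugate_hom:
  assumes "\<phi> \<in> hom H G" "h \<in> carrier G"
  shows "(\<lambda>g. inv h \<otimes> \<phi> g \<otimes> h) \<in> hom H G"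
proof (rule homI)
  have cancel: "h \<otimes> (inv h \<otimes> z) = z" if "z \<in> carrier G" for z
    using that assms(2) by (simp flip: m_assoc)
  fix x y assume "x \<in> carrier H" "y \<in> carrier H"
  with assms have "\<phi> x \<in> carrier G" "\<phi> y \<in> carrier G" "\<phi> (x \<otimes>\<^bsub>H\<^esub> y) = \<phi> x \<otimes> \<phi> y"
    by (auto simp: hom_in_carrier hom_mult)
  with assms show "inv h \<otimes> \<phi> (x \<otimes>\<^bsub>H\<^esub> y) \<otimes> h = inv h \<otimes> \<phi> x \<otimes> h \<otimes> (inv h \<otimes> \<phi> y \<otimes> h)"
    by (simp add: m_assoc cancel)
qed (use assms in \<open>auto simp: hom_in_carrier\<close>)

theorem proposition3p24:
  fixes k m l :: nat and t :: "nat \<Rightarrow> nat \<Rightarrow> nat"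
    and \<phi> :: "nat word set \<Rightarrow> nat \<Rightarrow> nat"
  assumes "m \<ge> 2" and "l dvd m" and "1 \<le> l" and "l < m"
    and "\<forall>i\<in>{1..<k}. \<forall>q\<in>{(i - 1) * l + 1..(i + 1) * l}. t i q \<in> {..<m div l}"
    and "\<phi> \<in> hom (braid_group k) (sym_group (m * k))"
    and "\<forall>i\<in>{1..<k}. \<phi> (braid_gen k i) = phi_perm k m l t i"
  shows "\<exists>p\<in>{..<m div l}. \<exists>\<phi>'\<in>hom (braid_group k) (sym_group (m * k)).
    (\<forall>i\<in>{1..<k}. \<phi>' (braid_gen k i) =
       phi_perm k m l (\<lambda>i q. if q = (i - 1) * l + 1 then p else 0) i) \<and>
    conjugate_homs (braid_group k) (sym_group (m * k)) \<phi> \<phi>'"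
proof -
  define n where "n = m div l"
  have m: "m = n * l" and n: "1 \<le> n"
    using assms(1-4) by (auto simp: n_def Suc_le_eq div_greater_zero_iff)
  interpret S: group "sym_group (m * k)"
    by (rule sym_group_is_group)
  note hom = hom_mult[OF assms(6)]
  have gen: "\<phi> (braid_gen k i) = phi_perm k (n * l) l t i" if "i \<in> {1..<k}" for i
    using assms(7) that m by simp
  have braid: "[t i (pt l i ((r + 1) mod l)) + t i (pt l (i + 1) ((r + 1) mod l)) =
      t (i + 1) (pt l (i + 1 + 1) r) + t (i + 1) (pt l (i + 1) ((r + 1) mod l))] (mod n)"
    if i: "i \<in> {1..<k}" "i + 1 \<in> {1..<k}" and r: "r < l" for i r
  proof (rule braid_phi_perm_cong[OF i r n])
    interpret B: group "braid_group k"
      by (rule group_braid_group)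
    note carrier = braid_gen_carrier[OF i(1)] braid_gen_carrier[OF i(2)]
    show "phi_perm k (n * l) l t i \<circ> phi_perm k (n * l) l t (i + 1) \<circ> phi_perm k (n * l) l t i =
        phi_perm k (n * l) l t (i + 1) \<circ> phi_perm k (n * l) l t i \<circ> phi_perm k (n * l) l t (i + 1)"
      using arg_cong[OF braid_gen_braid[OF i], of \<phi>] carrier
      by (simp only: hom B.m_closed gen[OF i(1)] gen[OF i(2)] sym_group_mult)
  qed
  \<comment> \<open>The first sum is c_1(r), forced by c_1(0) = 0 and c_1(s+1) = c_2(s) + a_1(s+1),
    where c_2(s) = c_1(s) + b_1(s); it kills a_1(1), ..., a_1(l-1). The second sum adds the b_x(r)
    with x < j, which kills all upper entries.\<close>
  define c where "c j r = (\<Sum>s<r. t 1 (pt l 2 s) + t 1 (pt l 1 (s + 1))) +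
    (\<Sum>x=1..<j. t x (pt l (x + 1) r))" for j r
  \<comment> \<open>What is left of a_1(0) when the residue wraps around from \<open>l - 1\<close>
    to 0, where \<open>c 1 0\<close> is the empty sum.\<close>
  define p where "p = (c 2 (l - 1) + t 1 (pt l 1 0)) mod n"
  define t' where "t' = (\<lambda>i q. if q = (i - 1) * l + 1 then p else 0)"
  define h where "h = C_perm id n 1 (k * l) (\<lambda>x. c ((x - 1) div l + 1) ((x - 1) mod l))"
  have c_Suc: "c (i + 1) r = c i r + t i (pt l (i + 1) r)" if "1 \<le> i" for i r
    using that by (simp add: c_def)
  \<comment> \<open>The exceptional index \<open>(i - 1) * l + 1\<close> is \<open>pt l i 0\<close>,
    residue 0 of the lower block.\<close>
  have t'_lower: "t' i (pt l i r) = (if r = 0 then p else 0)" for i r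
    by (simp add: t'_def pt_def mult.commute)
  have t'_upper: "t' i (pt l (i + 1) r) = 0" if "1 \<le> i" for i r
    using that assms(3) by (cases i) (auto simp: t'_def pt_def mult.commute)
  \<comment> \<open>The choice of \<open>c\<close> and \<open>p\<close> settles
    \<open>i = 1\<close>. The braid relations carry the congruence on to larger \<open>i\<close>,
    because the value of \<open>t' i (pt l i s)\<close> depends on \<open>s\<close> alone.\<close>
  have upper: "[c (i + 1) r + t i (pt l i ((r + 1) mod l)) =
      c i ((r + 1) mod l) + t' i (pt l i ((r + 1) mod l))] (mod n)"
    if "1 \<le> i" "i < k" "r < l" for i r
    using that
  proof (induction i rule: nat_induct_at_least)
    case base
    show ?case
    proof (cases "r + 1 < l")
      case True
      then show ?thesis
        by (simp add: t'_lower c_def numeral_2_eq_2 add.assoc)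
    next
      case False
      with base have "r + 1 = l" by simp
      then have "r = l - 1" "(r + 1) mod l = 0" by auto
      then show ?thesis
        by (simp add: t'_lower p_def c_def cong_def numeral_2_eq_2)
    qed
  next
    case (Suc i)
    let ?r = "(r + 1) mod l"
    \<comment> \<open>The left side is c_(i+2)(r) plus the entry a_(i+1) at \<open>?r\<close>. The
      braid relation trades b_(i+1)(r) and that entry for the entries of a_i and b_i at
      \<open>?r\<close>; the induction hypothesis absorbs a_i, and b_i turns \<open>c i ?r\<close>
      into \<open>c (i + 1) ?r\<close>.\<close>
    have "[c (i + 1) r + (t (i + 1) (pt l (i + 1 + 1) r) + t (i + 1) (pt l (i + 1) ?r)) =
        c (i + 1) r + (t i (pt l i ?r) + t i (pt l (i + 1) ?r))] (mod n)"
      using Suc by (intro cong_add cong_refl cong_sym[OF braid]) auto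
    also have "c (i + 1) r + (t i (pt l i ?r) + t i (pt l (i + 1) ?r)) =
        (c (i + 1) r + t i (pt l i ?r)) + t i (pt l (i + 1) ?r)"
      by simp
    also have "[\<dots> = (c i ?r + t' i (pt l i ?r)) + t i (pt l (i + 1) ?r)] (mod n)"
      using Suc by (intro cong_add cong_refl Suc.IH) auto
    finally show ?case
      using c_Suc[of "Suc i" r] c_Suc[of i ?r] Suc.hyps by (simp add: t'_lower ac_simps)
  qed
  have h: "h \<in> carrier (sym_group (m * k))"
    using C_perm_id_permutes[of n "k * l"] by (simp add: h_def sym_group_carrier m ac_simps)
  define \<phi>' where "\<phi>' g = inv\<^bsub>sym_group (m * k)\<^esub> h \<otimes>\<^bsub>sym_group (m * k)\<^esub> \<phi> g \<otimes>\<^bsub>sym_group (m * k)\<^esub> h" for g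
  have "\<phi>' (braid_gen k i) = phi_perm k m l t' i" if i: "i \<in> {1..<k}" for i
  proof -
    have "h \<circ> phi_perm k (n * l) l t' i = phi_perm k (n * l) l t i \<circ> h"
      unfolding h_def using i assms(3) n upper
      by (intro phi_perm_intertwine) (auto simp: c_Suc[simplified] t'_upper[simplified])
    then have "inv' h \<circ> (phi_perm k (n * l) l t i \<circ> h) = (inv' h \<circ> h) \<circ> phi_perm k (n * l) l t' i"
      by (simp only: comp_assoc)
    moreover have "inv' h \<circ> h = id"
      using h by (simp add: sym_group_carrier permutes_inv_o)
    ultimately show ?thesis
      using h gen[OF i] by (simp add: \<phi>'_def sym_group_mult m o_assoc)
  qed
  moreover have "\<phi>' \<in> hom (braid_group k) (sym_group (m * k))"
    using S.conjugate_hom[OF assms(6) h] by (simp only: \<phi>'_def[abs_def])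
  moreover have "conjugate_homs (braid_group k) (sym_group (m * k)) \<phi> \<phi>'"
    unfolding conjugate_homs_def using h by (intro bexI[of _ h] ballI) (simp_all only: \<phi>'_def)
  moreover have "p < m div l"
    using n by (simp add: p_def flip: n_def)
  ultimately show ?thesis
    by (intro bexI[of _ p] bexI[of _ \<phi>'] conjI ballI) (simp_all add: t'_def)
qed

end
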